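(* Let $P_n$ be the path on $n$ vertices. Then $\mathrm{ILN}(P_n) = O(\log n)$ as $n\to\infty$; that is, there exist constants $C>0$ and $n_0$ such that $\mathrm{ILN}(P_n)\le C\log n$ for all $n\ge n_0$.
   Context: Graphs are finite, simple and undirected. A valid labelling of a graph $G$ assigns to the vertices of $G$ pairwise distinct nonempty finite sets (labels) such that two distinct vertices are adjacent if and only if their labels are disjoint. The individual label number $\mathrm{ILN}(G)$ is the minimum, over all valid labellings of $G$, of the maximum cardinality of a vertex label. *)

theory Defs
  imports Complex_Main "Graph_Theory.Pair_Digraph"
begin

text \<open>
  A finite simple undirected graph is a \<^locale>\<open>pair_graph\<close>: each edge is represented by its two
  opposite arcs. The graph consists of finitely many vertices with finite labels, so taking the
  labels from the natural numbers loses no generality.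
\<close>

definition valid_labelling :: "'a pair_pre_digraph \<Rightarrow> ('a \<Rightarrow> nat set) \<Rightarrow> bool" where
  "valid_labelling G f \<longleftrightarrow>
     (\<forall>v\<in>pverts G. finite (f v) \<and> f v \<noteq> {}) \<and>
     inj_on f (pverts G) \<and>
     (\<forall>u\<in>pverts G. \<forall>v\<in>pverts G. u \<noteq> v \<longrightarrow> ((u, v) \<in> parcs G \<longleftrightarrow> f u \<inter> f v = {}))"

text \<open>The inserted 0 only matters for the null graph, where there is no label.\<close>

definition max_label_card :: "'a pair_pre_digraph \<Rightarrow> ('a \<Rightarrow> nat set) \<Rightarrow> nat" where
  "max_label_card G f = Max (insert 0 ((\<lambda>v. card (f v)) ` pverts G))"

definition ILN :: "'a pair_pre_digraph \<Rightarrow> nat" where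
  "ILN G = (LEAST k. \<exists>f. valid_labelling G f \<and> max_label_card G f = k)"

definition path_graph :: "nat \<Rightarrow> nat pair_pre_digraph" where
  "path_graph n =
     \<lparr>pverts = {..<n}, parcs = {(i, j). i < n \<and> j < n \<and> (j = Suc i \<or> i = Suc j)}\<rparr>"

lemma pair_graph_path_graph: "pair_graph (path_graph n)"
proof
  show "finite (parcs (path_graph n))"
    by (rule finite_subset[of _ "{..<n} \<times> {..<n}"]) (auto simp: path_graph_def)
  show "symmetric (with_proj (path_graph n))"
    by (auto simp: path_graph_def symmetric_def sym_def arcs_ends_def arc_to_ends_def)
qed (auto simp: path_graph_def)

text \<open>
  Every graph has a valid labelling, so the minimum defining \<^const>\<open>ILN\<close> is attained. Label each
  vertex by the set of all at most two-element vertex sets that contain it and are not edges.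
\<close>

lemma valid_labelling_exists:
  assumes "pair_graph G"
  shows "\<exists>f. valid_labelling G f"
proof -
  interpret pair_graph G by fact
  let ?V = "pverts G"
  define L where "L v = {{v, w} |w. w \<in> ?V \<and> (v, w) \<notin> parcs G}" for v
  have fin: "finite ?V" by (rule pair_finite_verts)
  have sym: "(u, v) \<in> parcs G \<longleftrightarrow> (v, u) \<in> parcs G" for u v
    using arcs_symmetric by blast
  have irr: "(v, v) \<notin> parcs G" for v
    using pair_no_loops[of "(v, v)"] by auto
  have self: "{v} \<in> L v" if "v \<in> ?V" for v
    unfolding L_def using that irr[of v] by (intro CollectI exI[of _ v]) simp
  have finL: "finite (L v)" for v
    unfolding L_def using fin by auto
  have disj: "(u, v) \<in> parcs G \<longleftrightarrow> L u \<inter> L v = {}"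
    if "u \<in> ?V" "v \<in> ?V" "u \<noteq> v" for u v
  proof
    assume uv: "(u, v) \<in> parcs G"
    show "L u \<inter> L v = {}"
      using uv sym[of u v] \<open>u \<noteq> v\<close> unfolding L_def by (force simp: doubleton_eq_iff)
  next
    assume disjoint: "L u \<inter> L v = {}"
    show "(u, v) \<in> parcs G"
    proof (rule ccontr)
      assume no: "(u, v) \<notin> parcs G"
      then have "{u, v} \<in> L u" using that unfolding L_def by blast
      moreover have "{v, u} \<in> L v" using no sym[of u v] that unfolding L_def by blast
      ultimately show False using disjoint by (auto simp: insert_commute)
    qed
  qed
  have mem: "v \<in> A" if "A \<in> L v" for A v
    using that unfolding L_def by blast
  have injL: "inj_on L ?V"
  proof (rule inj_onI)
    fix u v assume "u \<in> ?V" "L u = L v"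
    then have "{u} \<in> L v" using self by metis
    then show "u = v" using mem by blast
  qed
  have sub: "L v \<subseteq> Pow ?V" if "v \<in> ?V" for v
    using that unfolding L_def by auto
  obtain e :: "'a set \<Rightarrow> nat" where e: "inj_on e (Pow ?V)"
    using finite_imp_inj_to_nat_seg[of "Pow ?V"] fin by (metis finite_Pow_iff)
  have "valid_labelling G (\<lambda>v. e ` L v)"
    unfolding valid_labelling_def
  proof (intro conjI ballI impI)
    fix v assume "v \<in> ?V"
    then show "finite (e ` L v)" "e ` L v \<noteq> {}"
      using finL self by auto
  next
    show "inj_on (\<lambda>v. e ` L v) ?V"
    proof (rule inj_onI)
      fix u v assume uv: "u \<in> ?V" "v \<in> ?V" "e ` L u = e ` L v"
      then have "L u = L v" using inj_on_image_eq_iff[OF e sub sub] by blast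
      then show "u = v" using injL uv by (simp add: inj_on_eq_iff)
    qed
  next
    fix u v assume uv: "u \<in> ?V" "v \<in> ?V" "u \<noteq> v"
    have "e ` L u \<inter> e ` L v = e ` (L u \<inter> L v)"
      by (rule inj_on_image_Int[OF e sub[OF uv(1)] sub[OF uv(2)], symmetric])
    then show "(u, v) \<in> parcs G \<longleftrightarrow> e ` L u \<inter> e ` L v = {}"
      using disj[OF uv] by simp
  qed
  then show ?thesis by blast
qed

lemma ILN_attained:
  assumes "pair_graph G"
  shows "\<exists>f. valid_labelling G f \<and> max_label_card G f = ILN G"
proof -
  let ?P = "\<lambda>k. \<exists>f. valid_labelling G f \<and> max_label_card G f = k"
  have "\<exists>k. ?P k"
    using valid_labelling_exists[OF assms] by blast
  then have "?P (LEAST k. ?P k)"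
    by (rule LeastI_ex)
  then show ?thesis
    by (simp only: ILN_def)
qed

end

theory Submission
  imports Defs "HOL-Library.Countable"
begin

text \<open>
  A label element amounts to an independent set of the path, so the task is to cover the
  non-adjacent pairs by independent sets such that each vertex lies in \<open>O(log n)\<close> of them. Pairs of
  equal parity are covered by the two colour classes. For the others, halve the path recursively:
  at each dyadic block, let \<open>c\<close> be the first vertex of its right half. The even vertices of the
  left half together with the odd ones of the right half are independent. Odd left and even right
  vertices conflict only in the edge \<open>{c - 1, c}\<close>, so removing either \<open>c - 1\<close> or \<open>c\<close> gives two
  independent sets that cover the rest. Each vertex lies in one block per level.
\<close>

text \<open>
  The triple \<open>(k, q, t)\<close> with \<open>k \<ge> 1\<close> stands for the \<open>t\<close>-th independent set of the block
  \<open>[q 2\<^sup>k\<^sup>+\<^sup>1, (q + 1) 2\<^sup>k\<^sup>+\<^sup>1)\<close>. As \<open>i div 2\<^sup>k\<close> is odd exactly in the right half, the divisibility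
  conditions exclude only \<open>i = c - 1\<close> for \<open>t = 1\<close> and only \<open>i = c\<close> for \<open>t = 2\<close>.
  Level 0 holds a private element, for injectivity, and the colour class.
\<close>

definition dyadic_sets :: "nat \<Rightarrow> nat \<Rightarrow> nat set" where
  "dyadic_sets k i =
     (if odd i = odd (i div 2 ^ k) then {0}
      else {t. t = 1 \<and> \<not> 2 ^ k dvd Suc i \<or> t = 2 \<and> \<not> 2 ^ k dvd i})"

definition path_label :: "nat \<Rightarrow> nat \<Rightarrow> (nat \<times> nat \<times> nat) set" where
  "path_label K i =
     {(0, i, 0), (0, i mod 2, 1)} \<union>
     (SIGMA k:{1..K}. {i div 2 ^ Suc k} \<times> dyadic_sets k i)"

lemma same_half_less:
  fixes a b :: nat
  assumes "a div 2 = b div 2" "a < b"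
  shows "even a" "b = Suc a"
  using assms by presburger+

text \<open>Within one half the parities differ, so one side is \<open>{0}\<close> and the other
  avoids 0. Across the midpoint, \<open>i\<close> loses 1 and \<open>Suc i\<close> loses 2.\<close>

lemma dyadic_sets_Suc_disjoint:
  assumes "k \<ge> 1" "i div 2 ^ Suc k = Suc i div 2 ^ Suc k"
  shows "dyadic_sets k i \<inter> dyadic_sets k (Suc i) = {}"
proof (cases "2 ^ k dvd Suc i")
  case True
  have "even (Suc i)"
    using True \<open>k \<ge> 1\<close> by (meson dvd_power dvd_trans less_le_trans zero_less_one)
  have "Suc i div 2 ^ k = Suc (i div 2 ^ k)"
    using True by (simp add: div_Suc dvd_eq_mod_eq_0)
  moreover have "i div 2 ^ k div 2 = Suc i div 2 ^ k div 2"
    using assms(2) by (metis div_mult2_eq power_Suc2)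
  ultimately have "even (i div 2 ^ k)"
    using same_half_less by (metis lessI)
  then show ?thesis
    using True \<open>even (Suc i)\<close> \<open>Suc i div 2 ^ k = Suc (i div 2 ^ k)\<close>
    unfolding dyadic_sets_def by auto
next
  case False
  then have "Suc i div 2 ^ k = i div 2 ^ k"
    by (simp add: div_Suc dvd_eq_mod_eq_0)
  then show ?thesis
    unfolding dyadic_sets_def by auto
qed

lemma path_label_Suc_disjoint: "path_label K i \<inter> path_label K (Suc i) = {}"
proof -
  have False if *: "(k, q, t) \<in> path_label K i \<inter> path_label K (Suc i)" for k q t
  proof (cases "k = 0")
    case True
    moreover have "i mod 2 \<noteq> Suc i mod 2"
      by presburger
    ultimately show False
      using * unfolding path_label_def by auto
  next
    case False
    with * have "i div 2 ^ Suc k = Suc i div 2 ^ Suc k"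
      and "t \<in> dyadic_sets k i \<inter> dyadic_sets k (Suc i)"
      unfolding path_label_def by blast+
    then show False
      using dyadic_sets_Suc_disjoint[of k i] False by simp
  qed
  then show ?thesis
    by fast
qed

text \<open>The smallest dyadic block containing both vertices has them in different halves.\<close>

lemma dyadic_separation:
  fixes i j :: nat
  assumes "i < j" "j < 2 ^ Suc K"
  obtains k where "k \<le> K" "i div 2 ^ Suc k = j div 2 ^ Suc k"
    "even (i div 2 ^ k)" "j div 2 ^ k = Suc (i div 2 ^ k)"
proof -
  let ?P = "\<lambda>m. i div 2 ^ m = j div 2 ^ m"
  define m where "m = (LEAST m. ?P m)"
  have "?P (Suc K)"
    using assms by simp
  then have "?P m" "m \<le> Suc K"
    unfolding m_def by (fact LeastI, fact Least_le)
  moreover have "m \<noteq> 0"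
    using \<open>?P m\<close> \<open>i < j\<close> by (metis div_by_1 less_irrefl power_0)
  ultimately obtain k where k: "m = Suc k" "k \<le> K" "?P (Suc k)"
    by (cases m) auto
  have "i div 2 ^ k \<noteq> j div 2 ^ k"
    using not_less_Least[of k ?P] k(1) unfolding m_def by simp
  moreover have "i div 2 ^ k \<le> j div 2 ^ k"
    using \<open>i < j\<close> by (simp add: div_le_mono)
  moreover have "i div 2 ^ k div 2 = j div 2 ^ k div 2"
    using k(3) by (metis div_mult2_eq power_Suc2)
  ultimately have "even (i div 2 ^ k)" "j div 2 ^ k = Suc (i div 2 ^ k)"
    using same_half_less by (metis le_neq_implies_less)+
  then show thesis
    using that k by blast
qed

lemma path_label_intersect:
  assumes "i < j" "j \<noteq> Suc i" "j < 2 ^ Suc K"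
  shows "path_label K i \<inter> path_label K j \<noteq> {}"
proof (cases "i mod 2 = j mod 2")
  case True
  then show ?thesis
    unfolding path_label_def by auto
next
  case False
  obtain k where k: "k \<le> K" "i div 2 ^ Suc k = j div 2 ^ Suc k"
    "even (i div 2 ^ k)" "j div 2 ^ k = Suc (i div 2 ^ k)"
    using dyadic_separation assms by blast
  have "k \<noteq> 0"
    using k(4) \<open>j \<noteq> Suc i\<close> by (cases k) auto
  have even_if: "even x" if "2 ^ k dvd x" for x :: nat
    using that \<open>k \<noteq> 0\<close> by (meson dvd_power dvd_trans gr0I)
  \<comment> \<open>Otherwise \<open>i\<close> and \<open>j\<close> would be the two neighbours at
    the midpoint.\<close>
  have not_both: "\<not> (2 ^ k dvd Suc i \<and> 2 ^ k dvd j)"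
  proof
    assume dvd: "2 ^ k dvd Suc i \<and> 2 ^ k dvd j"
    then have "Suc i div 2 ^ k = j div 2 ^ k"
      using k(4) by (simp add: div_Suc dvd_eq_mod_eq_0)
    then show False
      using dvd \<open>j \<noteq> Suc i\<close> by (metis dvd_mult_div_cancel)
  qed
  have "dyadic_sets k i \<inter> dyadic_sets k j \<noteq> {}"
  proof (cases "even i")
    case True
    then have "odd j"
      using False by presburger
    then show ?thesis
      using True k unfolding dyadic_sets_def by simp
  next
    case odd: False
    then have "even j"
      using False by presburger
    then have "\<not> 2 ^ k dvd i" "\<not> 2 ^ k dvd Suc j"
      using odd even_if even_Suc by blast+
    \<comment> \<open>By parity, \<open>i\<close> always keeps 2 and \<open>j\<close> always keeps
      1; only a vertex at the midpoint lacks the other one.\<close>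
    then have "(if 2 ^ k dvd Suc i then 2 else 1) \<in> dyadic_sets k i \<inter> dyadic_sets k j"
      using odd \<open>even j\<close> k not_both unfolding dyadic_sets_def by auto
    then show ?thesis
      by blast
  qed
  then obtain t where "t \<in> dyadic_sets k i" "t \<in> dyadic_sets k j"
    by blast
  then have "(k, i div 2 ^ Suc k, t) \<in> path_label K i \<inter> path_label K j"
    using k(1,2) \<open>k \<noteq> 0\<close> unfolding path_label_def by auto
  then show ?thesis
    by blast
qed

lemma dyadic_sets_subset: "dyadic_sets k i \<subseteq> {0, 1, 2}"
  unfolding dyadic_sets_def by auto

lemma finite_dyadic_sets: "finite (dyadic_sets k i)"
  by (rule finite_subset[OF dyadic_sets_subset]) simp

lemma finite_path_label: "finite (path_label K i)"
  unfolding path_label_def by (simp add: finite_dyadic_sets)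

lemma card_path_label_le: "card (path_label K i) \<le> 2 + 3 * K"
proof -
  let ?B = "\<lambda>k. {i div 2 ^ Suc k} \<times> dyadic_sets k i"
  have "card (dyadic_sets k i) \<le> 3" for k
    using card_mono[OF _ dyadic_sets_subset, of k i] by simp
  then have "card (?B k) \<le> 3" for k
    by (simp add: card_cartesian_product)
  moreover have "finite (?B k)" for k
    by (simp add: finite_dyadic_sets)
  ultimately have "card (SIGMA k:{1..K}. ?B k) \<le> 3 * K"
    using sum_bounded_above[of "{1..K}" "\<lambda>k. card (?B k)" 3] by (simp add: mult.commute)
  moreover have "card {(0, i, 0), (0::nat, i mod 2, 1::nat)} = 2"
    by simp
  ultimately show ?thesis
    unfolding path_label_def by (intro order_trans[OF card_Un_le] add_mono) auto
qed

lemma inj_path_label: "inj (path_label K)"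
proof (rule injI)
  fix i j assume eq: "path_label K i = path_label K j"
  have "(0, i, 0) \<in> path_label K i"
    unfolding path_label_def by blast
  then have "(0, i, 0) \<in> path_label K j"
    by (simp only: eq)
  then show "i = j"
    unfolding path_label_def by auto
qed

text \<open>Injectivity of \<open>to_nat\<close> carries disjointness over to labels in the
  naturals.\<close>

lemma valid_labelling_path_graph:
  assumes "n \<le> 2 ^ Suc K"
  shows "valid_labelling (path_graph n) (\<lambda>i. to_nat ` path_label K i)"
proof -
  have adjacent_iff: "(j = Suc i \<or> i = Suc j) \<longleftrightarrow> path_label K i \<inter> path_label K j = {}"
    if "i < n" "j < n" "i \<noteq> j" for i j
    using that assms path_label_Suc_disjoint[of K i] path_label_Suc_disjoint[of K j]
      path_label_intersect[of i j K] path_label_intersect[of j i K]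
    by (cases i j rule: linorder_cases) (auto simp: Int_commute)
  have "to_nat ` A \<inter> to_nat ` B = {} \<longleftrightarrow> A \<inter> B = {}" for A B :: "(nat \<times> nat \<times> nat) set"
    by auto
  moreover have "path_label K i \<noteq> {}" for i
    unfolding path_label_def by blast
  moreover have "inj_on (\<lambda>i. to_nat ` path_label K i) {..<n}"
    by (rule inj_onI) (simp add: inj_image_eq_iff inj_eq[OF inj_path_label])
  ultimately show ?thesis
    using adjacent_iff
    unfolding valid_labelling_def path_graph_def by (simp add: finite_path_label)
qed

lemma ILN_le:
  assumes "valid_labelling G f"
  shows "ILN G \<le> max_label_card G f"
  unfolding ILN_def using assms by (blast intro: Least_le)

lemma ILN_path_graph_le:
  assumes "n \<le> 2 ^ Suc K"
  shows "ILN (path_graph n) \<le> 2 + 3 * K"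
proof -
  let ?f = "\<lambda>i. to_nat ` path_label K i"
  have "card (?f i) \<le> 2 + 3 * K" for i
    using card_path_label_le[of K i] by (simp add: card_image)
  then have "max_label_card (path_graph n) ?f \<le> 2 + 3 * K"
    unfolding max_label_card_def path_graph_def by auto
  then show ?thesis
    using ILN_le[OF valid_labelling_path_graph[OF assms]] by linarith
qed

theorem theorem27:
  shows "\<exists>C>0. \<exists>n0. \<forall>n\<ge>n0. real (ILN (path_graph n)) \<le> C * ln (real n)"
\<comment> \<open>From \<open>n \<ge> 2\<close> on, \<open>log 2 n \<ge> 1\<close> absorbs the
  additive 2, giving 2 + 3 = 5; \<open>ln 2\<close> changes the base.\<close>
proof (intro exI[of _ "5 / ln 2"] exI[of _ 2] conjI allI impI)
  fix n :: nat assume n: "n \<ge> 2"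
  define K where "K = nat \<lfloor>log 2 n\<rfloor>"
  have log_ge: "log 2 n \<ge> 1"
    using n by simp
  then have K: "real K \<le> log 2 n" "log 2 n < real (Suc K)"
    unfolding K_def by linarith+
  have "real n < 2 powr real (Suc K)"
    using K(2) n by (subst (asm) log_less_iff) auto
  then have "real n < 2 ^ Suc K"
    by (subst (asm) powr_realpow) auto
  then have "n \<le> 2 ^ Suc K"
    by (metis less_imp_le of_nat_less_iff of_nat_numeral of_nat_power)
  from ILN_path_graph_le[OF this] have "real (ILN (path_graph n)) \<le> 2 + 3 * real K"
    by linarith
  also have "\<dots> \<le> 5 * log 2 n"
    using K(1) log_ge by linarith
  finally show "real (ILN (path_graph n)) \<le> 5 / ln 2 * ln (real n)"
    by (simp add: log_def)
qed simp

end
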